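(* Let $\mathbb{T}=\{t_0,t_1,\dots,t_{n+2}\}$ be a non-uniform time grid, let $f:\mathbb{T}\times\mathbb{R}^2\to\mathbb{R}$ and $g:\mathbb{T}\to\mathbb{R}^+$ satisfy: (A1) for each $t_i$, the map $(x,y)\mapsto f(t_i,x,y)$ is continuous on $\mathbb{R}^2$, and for each $(x,y)\in\mathbb{R}^2$ the map $t_i\mapsto f(t_i,x,y)$ is continuous on $\mathbb{T}$ in the discrete sense; (A2) $f$ is non-increasing in its third variable; (A3) $g$ is continuous in the discrete sense. Consider the boundary value problem $$u^{\Delta\Delta}(t_{i-1})+f(t_i,u(t_i),u^\Delta(t_{i-1}))=0\ \ (i\in\{1,\dots,n+1\}),\qquad u^\Delta(t_0)=0,\qquad u(t_{n+2})=g(t_{n+2}).\qquad (P)$$ Let $\alpha$ and $\beta$ be a lower solution and an upper solution of (P), respectively, with $\alpha(t_i)\le\beta(t_i)$ for all $i\in\{0,1,\dots,n+1\}$. Then (P) has a solution $u:\mathbb{T}\to\mathbb{R}$ satisfying $\alpha(t_i)\le u(t_i)\le\beta(t_i)$ for all $i\in\{0,1,\dots,n+2\}$.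
   Context: Fix $n\in\mathbb{N}$, $n\geq 1$, and reals $a<b$. A non-uniform time grid is a strictly increasing sequence $\mathbb{T}=\{t_0,\dots,t_{n+2}\}$ with $a=t_0<t_1<\dots<t_{n+2}=b$. Step sizes: $h_i=t_{i+1}-t_i$ for $i=0,\dots,n+1$ (with $0<h_{\min}\le h_i\le h_{\max}$ for some constants). For $u:\mathbb{T}\to\mathbb{R}$, the delta derivative is $u^\Delta(t_i)=\frac{u(t_{i+1})-u(t_i)}{h_i}$ for $i=0,\dots,n+1$, and the second delta derivative is $u^{\Delta\Delta}(t_i)=\frac{u^\Delta(t_{i+1})-u^\Delta(t_i)}{h_i}$ for $i=0,\dots,n$. $\mathbb{R}^+=(0,\infty)$. Continuity "in the discrete sense" is continuity on the finite set $\mathbb{T}$ with its discrete topology (hence automatic). A solution of (P) is a function $u:\mathbb{T}\to\mathbb{R}$ satisfying the difference equation and both boundary conditions. A lower solution of (P) is a function $\alpha:\mathbb{T}\to\mathbb{R}$ with $\alpha^{\Delta\Delta}(t_{i-1})+f(t_i,\alpha(t_i),\alpha^\Delta(t_{i-1}))\ge 0$ for $i\in\{1,\dots,n+1\}$, $\alpha^\Delta(t_0)\ge 0$, and $\alpha(t_{n+2})\le g(t_{n+2})$. An upper solution of (P) is a function $\beta:\mathbb{T}\to\mathbb{R}$ with $\beta^{\Delta\Delta}(t_{i-1})+f(t_i,\beta(t_i),\beta^\Delta(t_{i-1}))\le 0$ for $i\in\{1,\dots,n+1\}$, $\beta^\Delta(t_0)\le 0$, and $\beta(t_{n+2})\ge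 g(t_{n+2})$. *)

theory Defs
  imports "HOL-Analysis.Analysis"
begin

text \<open>
  A grid is given by its enumeration \<open>t\<close>, of which only \<open>t 0, \<dots>, t (n + 2)\<close> matter.
  A function on the grid is a function on the reals of which only the values at grid points
  are ever used; its delta derivatives at \<open>t i\<close> are indexed by \<open>i\<close>.
\<close>

definition grid_points :: "nat \<Rightarrow> (nat \<Rightarrow> real) \<Rightarrow> real set" where
  "grid_points n t = t ` {0..n+2}"

definition step :: "(nat \<Rightarrow> real) \<Rightarrow> nat \<Rightarrow> real" where
  "step t i = t (i + 1) - t i"

text \<open>
  The bounds on the step sizes follow from strict monotonicity, since there are finitely many
  steps. Equal step sizes are not excluded.
\<close>

definition time_grid :: "nat \<Rightarrow> real \<Rightarrow> real \<Rightarrow> (nat \<Rightarrow> real) \<Rightarrow> bool" where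
  "time_grid n a b t \<longleftrightarrow>
     t 0 = a \<and> t (n + 2) = b \<and> strict_mono_on {0..n+2} t \<and>
     (\<exists>hmin hmax. 0 < hmin \<and> (\<forall>i\<in>{0..n+1}. hmin \<le> step t i \<and> step t i \<le> hmax))"

definition delta :: "(nat \<Rightarrow> real) \<Rightarrow> (real \<Rightarrow> real) \<Rightarrow> nat \<Rightarrow> real" where
  "delta t u i = (u (t (i + 1)) - u (t i)) / step t i"

definition delta2 :: "(nat \<Rightarrow> real) \<Rightarrow> (real \<Rightarrow> real) \<Rightarrow> nat \<Rightarrow> real" where
  "delta2 t u i = (delta t u (i + 1) - delta t u i) / step t i"

definition bvp_solution ::
  "nat \<Rightarrow> (nat \<Rightarrow> real) \<Rightarrow> (real \<Rightarrow> real \<Rightarrow> real \<Rightarrow> real) \<Rightarrow> (real \<Rightarrow> real) \<Rightarrow> (real \<Rightarrow> real) \<Rightarrow> bool" where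
  "bvp_solution n t f g u \<longleftrightarrow>
     (\<forall>i\<in>{1..n+1}. delta2 t u (i - 1) + f (t i) (u (t i)) (delta t u (i - 1)) = 0) \<and>
     delta t u 0 = 0 \<and> u (t (n + 2)) = g (t (n + 2))"

definition lower_solution ::
  "nat \<Rightarrow> (nat \<Rightarrow> real) \<Rightarrow> (real \<Rightarrow> real \<Rightarrow> real \<Rightarrow> real) \<Rightarrow> (real \<Rightarrow> real) \<Rightarrow> (real \<Rightarrow> real) \<Rightarrow> bool" where
  "lower_solution n t f g \<alpha> \<longleftrightarrow>
     (\<forall>i\<in>{1..n+1}. delta2 t \<alpha> (i - 1) + f (t i) (\<alpha> (t i)) (delta t \<alpha> (i - 1)) \<ge> 0) \<and>
     delta t \<alpha> 0 \<ge> 0 \<and> \<alpha> (t (n + 2)) \<le> g (t (n + 2))"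

definition upper_solution ::
  "nat \<Rightarrow> (nat \<Rightarrow> real) \<Rightarrow> (real \<Rightarrow> real \<Rightarrow> real \<Rightarrow> real) \<Rightarrow> (real \<Rightarrow> real) \<Rightarrow> (real \<Rightarrow> real) \<Rightarrow> bool" where
  "upper_solution n t f g \<beta> \<longleftrightarrow>
     (\<forall>i\<in>{1..n+1}. delta2 t \<beta> (i - 1) + f (t i) (\<beta> (t i)) (delta t \<beta> (i - 1)) \<le> 0) \<and>
     delta t \<beta> 0 \<le> 0 \<and> \<beta> (t (n + 2)) \<ge> g (t (n + 2))"

end

theory Submission
  imports Defs
begin

text \<open>
  Read at node \<open>i\<close>, the equation determines the slope \<open>u\<^sup>\<Delta>(t\<^sub>i)\<close>, hence \<open>u(t\<^sub>i\<^sub>+\<^sub>1)\<close>, from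
  \<open>u(t\<^sub>i)\<close> and the preceding slope \<open>u\<^sup>\<Delta>(t\<^sub>i\<^sub>-\<^sub>1)\<close>. With \<open>u\<^sup>\<Delta>(t\<^sub>0) = 0\<close> the problem is therefore an
  explicit recursion with one free parameter \<open>c = u(t\<^sub>0) = u(t\<^sub>1)\<close>, and the terminal value is a
  continuous function of \<open>c\<close>. One-dimensional shooting replaces a fixed point theorem.

  The recursion is run with \<open>f\<close> truncated in its second argument to the interval between
  \<open>\<alpha>\<close> and \<open>\<beta>\<close>. The central fact is that a trajectory \<open>u\<close> which lies on or above \<open>\<beta>\<close>, with at
  least the slope of \<open>\<beta>\<close>, can never come closer to \<open>\<beta>\<close> again (\<open>excess_mono\<close>): above \<open>\<beta>\<close> the
  truncated \<open>f\<close> sees only the value of \<open>\<beta>\<close>, and being non-increasing in the slope it lets the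
  larger slope lose no more than the smaller one does. Reflection \<open>u \<mapsto> -u\<close> gives the same for
  \<open>\<alpha>\<close> from below.

  This fact is used twice. Starting from \<open>c = \<beta>(t\<^sub>1)\<close> the trajectory ends at or above
  \<open>\<beta>(t\<^sub>n\<^sub>+\<^sub>2) \<ge> g(t\<^sub>n\<^sub>+\<^sub>2)\<close>, and from \<open>c = \<alpha>(t\<^sub>1)\<close> it ends at or below \<open>g(t\<^sub>n\<^sub>+\<^sub>2)\<close>, so by the
  intermediate value theorem some \<open>c\<close> between hits \<open>g(t\<^sub>n\<^sub>+\<^sub>2)\<close>. That trajectory cannot cross
  \<open>\<beta>\<close>, since after a crossing it would stay strictly above and miss its terminal value
  (\<open>below_barrier\<close>); likewise for \<open>\<alpha>\<close>. So the truncation is inactive and the trajectory solves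
  the original problem.
\<close>

section \<open>Comparison with a barrier\<close>

text \<open>
  A trajectory with values \<open>u\<close> and slopes \<open>v\<close>, compared with a barrier having values \<open>B\<close> and
  slopes \<open>w\<close>. The assumption \<open>truncated\<close> says that \<open>F\<close> is cut off at the barrier; \<open>N\<close> is the
  index of the last slope, so the values run up to index \<open>Suc N\<close>.
\<close>

locale upper_barrier =
  fixes N :: nat and h :: "nat \<Rightarrow> real" and F :: "nat \<Rightarrow> real \<Rightarrow> real \<Rightarrow> real"
    and u v B w :: "nat \<Rightarrow> real"
  assumes step_pos: "k \<le> N \<Longrightarrow> 0 < h k"
    and value_step: "k \<le> N \<Longrightarrow> u (Suc k) = u k + h k * v k"
    and slope_step: "k < N \<Longrightarrow> v (Suc k) = v k - h k * F (Suc k) (u (Suc k)) (v k)"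
    and barrier_value_step: "k \<le> N \<Longrightarrow> B (Suc k) = B k + h k * w k"
    and barrier_slope_step: "k < N \<Longrightarrow> w (Suc k) \<le> w k - h k * F (Suc k) (B (Suc k)) (w k)"
    and truncated: "k < N \<Longrightarrow> B (Suc k) \<le> x \<Longrightarrow> F (Suc k) x y = F (Suc k) (B (Suc k)) y"
    and antimono_slope: "k < N \<Longrightarrow> y \<le> z \<Longrightarrow> F (Suc k) x z \<le> F (Suc k) x y"
begin

text \<open>
  The values and slopes must be propagated together: the order of the values activates the
  truncation, which preserves the order of the slopes, which in turn makes the excess grow.
\<close>

lemma excess_mono:
  assumes start: "w m \<le> v m" "B (Suc m) \<le> u (Suc m)"
    and "m \<le> k" "k \<le> N"
  shows "w k \<le> v k \<and> u (Suc m) - B (Suc m) \<le> u (Suc k) - B (Suc k)"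
  using \<open>m \<le> k\<close> \<open>k \<le> N\<close>
proof (induction k rule: dec_induct)
  case base
  show ?case using start by simp
next
  case (step k)
  hence k: "k < N" and slopes: "w k \<le> v k"
    and excess: "u (Suc m) - B (Suc m) \<le> u (Suc k) - B (Suc k)" by auto
  hence "B (Suc k) \<le> u (Suc k)" using start by linarith
  hence "F (Suc k) (u (Suc k)) (v k) = F (Suc k) (B (Suc k)) (v k)"
    using truncated k by blast
  also have "\<dots> \<le> F (Suc k) (B (Suc k)) (w k)"
    using antimono_slope k slopes by blast
  finally have "h k * F (Suc k) (u (Suc k)) (v k) \<le> h k * F (Suc k) (B (Suc k)) (w k)"
    using step_pos[of k] k by simp
  hence slopes': "w (Suc k) \<le> v (Suc k)"
    using slope_step[OF k] barrier_slope_step[OF k] slopes by linarith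
  hence "h (Suc k) * w (Suc k) \<le> h (Suc k) * v (Suc k)"
    using step_pos[of "Suc k"] k by simp
  thus ?case
    using slopes' excess value_step[of "Suc k"] barrier_value_step[of "Suc k"] k by simp
qed

text \<open>
  At the first index where the trajectory exceeds the barrier its last slope was larger than that
  of the barrier, so the excess persists up to the terminal index.
\<close>

lemma below_barrier:
  assumes initial: "u (Suc 0) \<le> B (Suc 0)" and terminal: "u (Suc N) \<le> B (Suc N)"
    and "k \<le> N"
  shows "u (Suc k) \<le> B (Suc k)"
proof (rule ccontr)
  assume "\<not> u (Suc k) \<le> B (Suc k)"
  define j where "j = (LEAST j. B (Suc j) < u (Suc j))"
  have "B (Suc k) < u (Suc k)" using \<open>\<not> u (Suc k) \<le> B (Suc k)\<close> by simp
  hence above: "B (Suc j) < u (Suc j)" and "j \<le> k"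
    unfolding j_def by (rule LeastI, rule Least_le)
  obtain i where i: "j = Suc i" using above initial by (cases j) auto
  have "u j \<le> B j"
    using not_less_Least[of i "\<lambda>j. B (Suc j) < u (Suc j)"] i unfolding j_def by fastforce
  hence "h j * w j < h j * v j"
    using above value_step[of j] barrier_value_step[of j] \<open>j \<le> k\<close> \<open>k \<le> N\<close> by linarith
  hence "w j \<le> v j" using step_pos[of j] \<open>j \<le> k\<close> \<open>k \<le> N\<close> by simp
  hence "u (Suc j) - B (Suc j) \<le> u (Suc N) - B (Suc N)"
    using excess_mono[of j N] above \<open>j \<le> k\<close> \<open>k \<le> N\<close> by simp
  thus False using above terminal by linarith
qed

end

section \<open>The shooting recursion\<close>

text \<open>The pair of value and slope at node \<open>k\<close> on the trajectory that starts at \<open>c\<close> with slope zero.\<close>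

primrec shoot :: "(nat \<Rightarrow> real) \<Rightarrow> (nat \<Rightarrow> real \<Rightarrow> real \<Rightarrow> real) \<Rightarrow> real \<Rightarrow> nat \<Rightarrow> real \<times> real" where
  "shoot h F c 0 = (c, 0)"
| "shoot h F c (Suc k) =
     (let x = fst (shoot h F c k) + h k * snd (shoot h F c k)
      in (x, snd (shoot h F c k) - h k * F (Suc k) x (snd (shoot h F c k))))"

lemma fst_shoot_Suc: "fst (shoot h F c (Suc k)) = fst (shoot h F c k) + h k * snd (shoot h F c k)"
  by (simp add: Let_def)

lemma snd_shoot_Suc:
  "snd (shoot h F c (Suc k)) =
     snd (shoot h F c k) - h k * F (Suc k) (fst (shoot h F c (Suc k))) (snd (shoot h F c k))"
  by (simp add: Let_def)

lemma continuous_on_shoot: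
  assumes "\<And>i. i \<in> {1..k} \<Longrightarrow> continuous_on UNIV (\<lambda>(x, y). F i x y)"
  shows "continuous_on UNIV (\<lambda>c. shoot h F c k)"
  using assms
proof (induction k)
  case 0
  show ?case by (simp add: continuous_on_Pair)
next
  case (Suc k)
  have IH: "continuous_on UNIV (\<lambda>c. shoot h F c k)" using Suc by simp
  have x: "continuous_on UNIV (\<lambda>c. fst (shoot h F c (Suc k)))"
    unfolding fst_shoot_Suc by (intro continuous_intros IH)
  have "continuous_on UNIV (\<lambda>(x, y). F (Suc k) x y)" using Suc.prems by simp
  hence "continuous_on UNIV
      (\<lambda>c. (\<lambda>(x, y). F (Suc k) x y) (fst (shoot h F c (Suc k)), snd (shoot h F c k)))"
    by (rule continuous_on_compose2) (intro continuous_intros x IH subset_UNIV)+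
  hence "continuous_on UNIV (\<lambda>c. F (Suc k) (fst (shoot h F c (Suc k))) (snd (shoot h F c k)))"
    by simp
  hence "continuous_on UNIV (\<lambda>c. snd (shoot h F c (Suc k)))"
    unfolding snd_shoot_Suc by (intro continuous_intros IH)
  with x have "continuous_on UNIV (\<lambda>c. (fst (shoot h F c (Suc k)), snd (shoot h F c (Suc k))))"
    by (rule continuous_on_Pair)
  thus ?case by simp
qed

section \<open>Existence of a solution between ordered lower and upper solutions\<close>

theorem theorem1p8:
  fixes n :: nat and a b :: real and t :: "nat \<Rightarrow> real"
    and f :: "real \<Rightarrow> real \<Rightarrow> real \<Rightarrow> real"
    and g \<alpha> \<beta> :: "real \<Rightarrow> real"
  assumes "n \<ge> 1" and "a < b"
    and grid: "time_grid n a b t"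
    and g_pos: "\<forall>s\<in>grid_points n t. g s > 0"
    and A1_xy: "\<forall>s\<in>grid_points n t. continuous_on UNIV (\<lambda>(x, y). f s x y)"
    and A1_t: "\<forall>x y. continuous_map (discrete_topology (grid_points n t)) euclideanreal (\<lambda>s. f s x y)"
    and A2: "\<forall>s\<in>grid_points n t. \<forall>x. antimono (\<lambda>y. f s x y)"
    and A3: "continuous_map (discrete_topology (grid_points n t)) euclideanreal g"
    and lower: "lower_solution n t f g \<alpha>"
    and upper: "upper_solution n t f g \<beta>"
    and ordered: "\<forall>i\<in>{0..n+1}. \<alpha> (t i) \<le> \<beta> (t i)"
  shows "\<exists>u :: real \<Rightarrow> real. bvp_solution n t f g u \<and>
           (\<forall>i\<in>{0..n+2}. \<alpha> (t i) \<le> u (t i) \<and> u (t i) \<le> \<beta> (t i))"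
proof -
  define h where "h = step t"
  define A where "A k = \<alpha> (t k)" for k
  define B where "B k = \<beta> (t k)" for k
  define F where "F k x y = f (t k) (max (A k) (min (B k) x)) y" for k x y
  define N where "N = Suc n"

  have h_pos: "0 < h k" if "k \<le> N" for k
  proof -
    obtain hmin where "0 < hmin" "\<forall>i\<in>{0..n+1}. hmin \<le> step t i"
      using grid unfolding time_grid_def by auto
    thus ?thesis using that unfolding h_def N_def by force
  qed
  have AB: "A k \<le> B k" if "k \<le> N" for k
    using ordered that by (simp add: A_def B_def N_def)
  have node: "t k \<in> grid_points n t" if "k \<le> N" for k
    using that unfolding grid_points_def N_def by simp
  have F_anti: "F k x z \<le> F k x y" if "k \<le> N" "y \<le> z" for k x y z
    using A2 node that unfolding F_def antimono_def by blast
  have F_cont: "continuous_on UNIV (\<lambda>(x, y). F k x y)" if "k \<le> N" for k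
  proof -
    have "continuous_on UNIV (\<lambda>p. (\<lambda>(x, y). f (t k) x y) (max (A k) (min (B k) (fst p)), snd p))"
      by (rule continuous_on_compose2[where s = UNIV and t = UNIV])
        (use A1_xy node that in \<open>auto intro!: continuous_intros\<close>)
    thus ?thesis by (simp add: F_def case_prod_beta)
  qed

  have value_steps: "x (t (Suc k)) = x (t k) + h k * delta t x k" if "k \<le> N" for k x
    using h_pos[OF that] by (simp add: delta_def h_def)
  have slope_steps: "delta t x (Suc k) = delta t x k + h k * delta2 t x k" if "k \<le> N" for k x
    using h_pos[OF that] by (simp add: delta2_def h_def)

  define U where "U c k = fst (shoot h F c k)" for c k
  define V where "V c k = snd (shoot h F c k)" for c k
  have V0: "V c 0 = 0" and U1: "U c (Suc 0) = c" for c by (simp_all add: U_def V_def)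
  have U_Suc: "U c (Suc k) = U c k + h k * V c k" for c k
    unfolding U_def V_def by (rule fst_shoot_Suc)
  have V_Suc: "V c (Suc k) = V c k - h k * F (Suc k) (U c (Suc k)) (V c k)" for c k
    unfolding U_def V_def by (rule snd_shoot_Suc)

  have beta: "upper_barrier N h F (U c) (V c) B (delta t \<beta>)" for c
  proof
    fix k assume k: "k < N"
    have "delta2 t \<beta> k + f (t (Suc k)) (\<beta> (t (Suc k))) (delta t \<beta> k) \<le> 0"
      using upper k unfolding upper_solution_def N_def by (auto dest: bspec[of _ _ "Suc k"])
    hence "delta2 t \<beta> k \<le> - F (Suc k) (B (Suc k)) (delta t \<beta> k)"
      using AB[of "Suc k"] k by (simp add: F_def B_def)
    from mult_left_mono[OF this, of "h k"]
    show "delta t \<beta> (Suc k) \<le> delta t \<beta> k - h k * F (Suc k) (B (Suc k)) (delta t \<beta> k)"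
      using slope_steps[of k \<beta>] h_pos[of k] k by simp
  qed (use h_pos U_Suc V_Suc value_steps F_anti AB in \<open>auto simp: F_def B_def\<close>)
  \<comment> \<open>Both sign changes together keep the nonlinearity non-increasing in the slope.\<close>
  have alpha: "upper_barrier N h (\<lambda>k x y. - F k (- x) (- y)) (\<lambda>k. - U c k) (\<lambda>k. - V c k)
      (\<lambda>k. - A k) (\<lambda>k. - delta t \<alpha> k)" for c
  proof
    fix k assume k: "k < N"
    have "delta2 t \<alpha> k + f (t (Suc k)) (\<alpha> (t (Suc k))) (delta t \<alpha> k) \<ge> 0"
      using lower k unfolding lower_solution_def N_def by (auto dest: bspec[of _ _ "Suc k"])
    hence "- F (Suc k) (A (Suc k)) (delta t \<alpha> k) \<le> delta2 t \<alpha> k"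
      using AB[of "Suc k"] k by (simp add: F_def A_def)
    from mult_left_mono[OF this, of "h k"]
    show "- delta t \<alpha> (Suc k)
        \<le> - delta t \<alpha> k - h k * (- F (Suc k) (- (- A (Suc k))) (- (- delta t \<alpha> k)))"
      using slope_steps[of k \<alpha>] h_pos[of k] k by simp
  next
    fix k x y assume k: "k < N" and x: "- A (Suc k) \<le> x"
    hence "max (A (Suc k)) (min (B (Suc k)) (- x)) = A (Suc k)" by auto
    thus "- F (Suc k) (- x) (- y) = - F (Suc k) (- (- A (Suc k))) (- y)"
      using AB[of "Suc k"] k by (simp add: F_def)
  next
    fix k assume "k < N"
    show "- V c (Suc k) = - V c k - h k * (- F (Suc k) (- (- U c (Suc k))) (- (- V c k)))"
      using V_Suc[of c k] by simp
  next
    fix k assume "k \<le> N"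
    show "- A (Suc k) = - A k + h k * (- delta t \<alpha> k)"
      using value_steps[OF \<open>k \<le> N\<close>, of \<alpha>] by (simp add: A_def)
  qed (simp_all add: h_pos U_Suc F_anti)

  have ends: "A (Suc N) \<le> g (t (n + 2))" "g (t (n + 2)) \<le> B (Suc N)"
    using lower upper unfolding lower_solution_def upper_solution_def A_def B_def N_def by auto
  have slopes0: "0 \<le> delta t \<alpha> 0" "delta t \<beta> 0 \<le> 0"
    using lower upper unfolding lower_solution_def upper_solution_def by auto

  have "U (A 1) (Suc N) \<le> A (Suc N)"
    using upper_barrier.excess_mono[OF alpha, of 0 "A 1" N] slopes0 V0[of "A 1"] U1[of "A 1"] by simp
  moreover have "B (Suc N) \<le> U (B 1) (Suc N)"
    using upper_barrier.excess_mono[OF beta, of 0 "B 1" N] slopes0 V0[of "B 1"] U1[of "B 1"] by simp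
  moreover have "continuous_on {A 1..B 1} (\<lambda>c. U c (Suc N))"
  proof -
    have "continuous_on UNIV (\<lambda>c. shoot h F c N)"
      by (rule continuous_on_shoot) (simp add: F_cont)
    hence "continuous_on UNIV (\<lambda>c. U c (Suc N))"
      unfolding U_def fst_shoot_Suc by (intro continuous_intros)
    thus ?thesis by (rule continuous_on_subset) simp
  qed
  moreover have "A 1 \<le> B 1" using AB[of 1] by (simp add: N_def)
  ultimately obtain c where c: "A 1 \<le> c" "c \<le> B 1" and hit: "U c (Suc N) = g (t (n + 2))"
    using ends IVT'[of "\<lambda>c. U c (Suc N)" "A 1" "g (t (n + 2))" "B 1"] by force

  have between: "A k \<le> U c k \<and> U c k \<le> B k" if "k \<le> Suc N" for k
  proof (cases k)
    case (Suc j)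
    thus ?thesis
      using upper_barrier.below_barrier[OF beta, of c j] upper_barrier.below_barrier[OF alpha, of c j]
        U1[of c] c hit ends that by simp
  next
    case 0
    have "h 0 * delta t \<beta> 0 \<le> 0" "0 \<le> h 0 * delta t \<alpha> 0"
      using h_pos[of 0] slopes0 by (auto simp: mult_le_0_iff)
    hence "A 0 \<le> A 1" "B 1 \<le> B 0"
      using value_steps[of 0 \<alpha>] value_steps[of 0 \<beta>] by (auto simp: A_def B_def)
    thus ?thesis using 0 c U_Suc[of c 0] U1[of c] V0[of c] by simp
  qed

  have "inj_on t {0..n+2}"
    using grid strict_mono_on_imp_inj_on unfolding time_grid_def by blast
  define u where "u s = U c (the_inv_into {0..n+2} t s)" for s
  have u: "u (t k) = U c k" if "k \<le> Suc N" for k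
    using the_inv_into_f_f[OF \<open>inj_on t {0..n+2}\<close>, of k] that by (simp add: u_def N_def)
  have slope: "delta t u k = V c k" if "k \<le> N" for k
  proof -
    have "u (t (Suc k)) - u (t k) = h k * V c k" using u[of k] u[of "Suc k"] U_Suc[of c k] that by simp
    thus ?thesis using h_pos[OF that] by (simp add: delta_def flip: h_def)
  qed
  have equation: "delta2 t u k + f (t (Suc k)) (u (t (Suc k))) (delta t u k) = 0" if "k < N" for k
  proof -
    have "V c (Suc k) - V c k = h k * (- F (Suc k) (U c (Suc k)) (V c k))"
      using V_Suc[of c k] by linarith
    hence "delta2 t u k = - F (Suc k) (U c (Suc k)) (V c k)"
      using h_pos[of k] slope[of k] slope[of "Suc k"] that by (simp add: delta2_def flip: h_def)
    thus ?thesis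
      using between[of "Suc k"] u[of "Suc k"] slope[of k] that by (simp add: F_def)
  qed
  have "bvp_solution n t f g u"
    unfolding bvp_solution_def
  proof (intro conjI ballI)
    fix i assume "i \<in> {1..n+1}"
    hence "i - 1 < N" "Suc (i - 1) = i" by (auto simp: N_def)
    thus "delta2 t u (i - 1) + f (t i) (u (t i)) (delta t u (i - 1)) = 0"
      using equation[of "i - 1"] by simp
  next
    show "delta t u 0 = 0" using slope[of 0] V0[of c] by simp
    show "u (t (n + 2)) = g (t (n + 2))" using u[of "Suc N"] hit by (simp add: N_def)
  qed
  moreover have "\<alpha> (t i) \<le> u (t i) \<and> u (t i) \<le> \<beta> (t i)" if "i \<in> {0..n+2}" for i
    using between[of i] u[of i] that by (simp add: A_def B_def N_def)
  ultimately show ?thesis by blast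
qed

end
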